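(* Let $R$ be a ring and let $M$ be a left $R$-module with $RM\neq\{0\}$. Then the following implications hold: (i) if $M$ is completely co-prime, then $M$ is completely prime; (ii) if $M$ is completely prime, then $M$ is prime; (iii) if $M$ is completely co-prime, then $M$ is co-prime.
   Context: Rings are associative and unital; modules are left unital modules. $N\le M$ means $N$ is a submodule of $M$. For $N\le M$ and $m\in M$, $(N:m)=\{r\in R : rm\in N\}$ and $(N:M)=\{r\in R : rM\subseteq N\}$; we write $(0:m)$, $(0:M)$ for $N=\{0\}$, and for a submodule $N$, $(0:N)=\{r\in R: rN=\{0\}\}$. An $R$-module $M$ with $RM\ne\{0\}$ is: prime if $(0:N)=(0:M)$ for all nonzero submodules $N$ of $M$; completely prime if $(0:m)=(0:M)$ for all nonzero $m\in M$; co-prime if $(N:M)=(0:M)$ for all proper submodules $N$ of $M$; completely co-prime if $(N:m)=(0:M)$ for all submodules $N$ of $M$ and all $m\in M\setminus N$. *)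

theory Defs
  imports "HOL-Algebra.Module"
begin

(* The locale module of HOL-Algebra requires a commutative base ring; this is the same
   list of axioms over an arbitrary associative unital ring. *)
locale left_module = R?: ring R + M?: abelian_group M for R (structure) and M (structure) +
  assumes smult_closed [simp, intro]:
      "\<lbrakk>a \<in> carrier R; x \<in> carrier M\<rbrakk> \<Longrightarrow> a \<odot>\<^bsub>M\<^esub> x \<in> carrier M"
    and smult_l_distr:
      "\<lbrakk>a \<in> carrier R; b \<in> carrier R; x \<in> carrier M\<rbrakk> \<Longrightarrow>
        (a \<oplus>\<^bsub>R\<^esub> b) \<odot>\<^bsub>M\<^esub> x = a \<odot>\<^bsub>M\<^esub> x \<oplus>\<^bsub>M\<^esub> b \<odot>\<^bsub>M\<^esub> x"
    and smult_r_distr: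
      "\<lbrakk>a \<in> carrier R; x \<in> carrier M; y \<in> carrier M\<rbrakk> \<Longrightarrow>
        a \<odot>\<^bsub>M\<^esub> (x \<oplus>\<^bsub>M\<^esub> y) = a \<odot>\<^bsub>M\<^esub> x \<oplus>\<^bsub>M\<^esub> a \<odot>\<^bsub>M\<^esub> y"
    and smult_assoc1:
      "\<lbrakk>a \<in> carrier R; b \<in> carrier R; x \<in> carrier M\<rbrakk> \<Longrightarrow>
        (a \<otimes>\<^bsub>R\<^esub> b) \<odot>\<^bsub>M\<^esub> x = a \<odot>\<^bsub>M\<^esub> (b \<odot>\<^bsub>M\<^esub> x)"
    and smult_one [simp]:
      "x \<in> carrier M \<Longrightarrow> \<one>\<^bsub>R\<^esub> \<odot>\<^bsub>M\<^esub> x = x"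

lemma (in module) left_module: "left_module R M"
  by (intro left_module.intro left_module_axioms.intro R.ring_axioms M.abelian_group_axioms)
    (simp_all add: smult_l_distr smult_r_distr smult_assoc1)

(* The elementwise product A X = {a x | a in A, x in X}. No finite sums are taken:
   it is used only for r X = {r} X, and for R M, which for a unital module is all of M. *)
definition smult_set :: "('a, 'b, 'n) module_scheme \<Rightarrow> 'a set \<Rightarrow> 'b set \<Rightarrow> 'b set" where
  "smult_set M A X = {a \<odot>\<^bsub>M\<^esub> x |a x. a \<in> A \<and> x \<in> X}"

definition colon_elem ::
    "('a, 'm) ring_scheme \<Rightarrow> ('a, 'b, 'n) module_scheme \<Rightarrow> 'b set \<Rightarrow> 'b \<Rightarrow> 'a set" where
  "colon_elem R M N m = {r \<in> carrier R. r \<odot>\<^bsub>M\<^esub> m \<in> N}"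

definition colon_module ::
    "('a, 'm) ring_scheme \<Rightarrow> ('a, 'b, 'n) module_scheme \<Rightarrow> 'b set \<Rightarrow> 'a set" where
  "colon_module R M N = {r \<in> carrier R. smult_set M {r} (carrier M) \<subseteq> N}"

definition annihilator ::
    "('a, 'm) ring_scheme \<Rightarrow> ('a, 'b, 'n) module_scheme \<Rightarrow> 'b set \<Rightarrow> 'a set" where
  "annihilator R M N = {r \<in> carrier R. smult_set M {r} N = {\<zero>\<^bsub>M\<^esub>}}"

definition nonzero_module ::
    "('a, 'm) ring_scheme \<Rightarrow> ('a, 'b, 'n) module_scheme \<Rightarrow> bool" where
  "nonzero_module R M \<longleftrightarrow>
     left_module R M \<and> smult_set M (carrier R) (carrier M) \<noteq> {\<zero>\<^bsub>M\<^esub>}"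

definition prime_module ::
    "('a, 'm) ring_scheme \<Rightarrow> ('a, 'b, 'n) module_scheme \<Rightarrow> bool" where
  "prime_module R M \<longleftrightarrow> nonzero_module R M \<and>
     (\<forall>N. submodule N R M \<and> N \<noteq> {\<zero>\<^bsub>M\<^esub>} \<longrightarrow>
        annihilator R M N = colon_module R M {\<zero>\<^bsub>M\<^esub>})"

definition completely_prime_module ::
    "('a, 'm) ring_scheme \<Rightarrow> ('a, 'b, 'n) module_scheme \<Rightarrow> bool" where
  "completely_prime_module R M \<longleftrightarrow> nonzero_module R M \<and>
     (\<forall>m \<in> carrier M. m \<noteq> \<zero>\<^bsub>M\<^esub> \<longrightarrow>
        colon_elem R M {\<zero>\<^bsub>M\<^esub>} m = colon_module R M {\<zero>\<^bsub>M\<^esub>})"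

definition coprime_module ::
    "('a, 'm) ring_scheme \<Rightarrow> ('a, 'b, 'n) module_scheme \<Rightarrow> bool" where
  "coprime_module R M \<longleftrightarrow> nonzero_module R M \<and>
     (\<forall>N. submodule N R M \<and> N \<noteq> carrier M \<longrightarrow>
        colon_module R M N = colon_module R M {\<zero>\<^bsub>M\<^esub>})"

definition completely_coprime_module ::
    "('a, 'm) ring_scheme \<Rightarrow> ('a, 'b, 'n) module_scheme \<Rightarrow> bool" where
  "completely_coprime_module R M \<longleftrightarrow> nonzero_module R M \<and>
     (\<forall>N. submodule N R M \<longrightarrow> (\<forall>m \<in> carrier M - N.
        colon_elem R M N m = colon_module R M {\<zero>\<^bsub>M\<^esub>}))"

end

theory Submission
  imports Defs
begin

text \<open>Everything follows from instantiating a condition on elements and sandwiching. Taking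
  \<open>N = {0}\<close> in complete co-primeness leaves exactly the condition on nonzero elements;
  this needs \<open>{0}\<close> to be a submodule (\<open>submodule_zero\<close>). For a nonzero
  submodule \<open>N\<close>, any nonzero \<open>m\<close> in \<open>N\<close> gives (0:M)
  \<subseteq> (0:N) \<subseteq> (0:m), and complete primeness makes the two ends equal. Dually, for
  a proper \<open>N\<close>, any \<open>m\<close> outside \<open>N\<close> gives (0:M) \<subseteq>
  (N:M) \<subseteq> (N:m), and complete co-primeness makes the ends equal.\<close>

lemma submodule_zero_closed: "submodule N R M \<Longrightarrow> \<zero>\<^bsub>M\<^esub> \<in> N"
  using subgroup.one_closed[OF submodule.axioms(1)] by fastforce

lemma submodule_carrier_subset: "submodule N R M \<Longrightarrow> N \<subseteq> carrier M"
  using subgroup.subset[OF submodule.axioms(1)] by fastforce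

context left_module
begin

text \<open>Distributing \<open>a\<close> over 0 + 0 shows that a0 is its own double, so it cancels
  to 0 in the additive group. This is what makes \<open>{0}\<close> closed under scalars.\<close>

lemma smult_r_null [simp]:
  assumes "a \<in> carrier R"
  shows "a \<odot>\<^bsub>M\<^esub> \<zero>\<^bsub>M\<^esub> = \<zero>\<^bsub>M\<^esub>"
proof -
  have "a \<odot>\<^bsub>M\<^esub> \<zero>\<^bsub>M\<^esub> \<oplus>\<^bsub>M\<^esub> a \<odot>\<^bsub>M\<^esub> \<zero>\<^bsub>M\<^esub> = a \<odot>\<^bsub>M\<^esub> \<zero>\<^bsub>M\<^esub>"
    using smult_r_distr[OF assms M.zero_closed M.zero_closed] by simp
  then show ?thesis
    using assms by (metis M.add.l_cancel_one smult_closed M.zero_closed)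
qed

lemma submodule_zero: "submodule {\<zero>\<^bsub>M\<^esub>} R M"
  by (intro submodule.intro submodule_axioms.intro M.add.triv_subgroup) simp

text \<open>The elements outside the zero submodule are precisely the nonzero ones, so this is the
  instance \<open>N = {0}\<close>.\<close>

lemma completely_coprime_imp_completely_prime:
  assumes "completely_coprime_module R M"
  shows "completely_prime_module R M"
  using assms submodule_zero
  unfolding completely_coprime_module_def completely_prime_module_def by blast

lemma completely_prime_imp_prime:
  assumes "completely_prime_module R M"
  shows "prime_module R M"
proof -
  have "annihilator R M N = colon_module R M {\<zero>\<^bsub>M\<^esub>}"
    if N: "submodule N R M" and nz: "N \<noteq> {\<zero>\<^bsub>M\<^esub>}" for N
  proof
    \<comment> \<open>Since \<open>N\<close> contains 0 and differs from \<open>{0}\<close>, it has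
      a further element.\<close>
    obtain m where m: "m \<in> N" "m \<noteq> \<zero>\<^bsub>M\<^esub>"
      using submodule_zero_closed[OF N] nz by blast
    then have "colon_elem R M {\<zero>\<^bsub>M\<^esub>} m = colon_module R M {\<zero>\<^bsub>M\<^esub>}"
      using assms submodule_carrier_subset[OF N]
      unfolding completely_prime_module_def by blast
    moreover have "annihilator R M N \<subseteq> colon_elem R M {\<zero>\<^bsub>M\<^esub>} m"
      using m(1) unfolding annihilator_def colon_elem_def smult_set_def by blast
    ultimately show "annihilator R M N \<subseteq> colon_module R M {\<zero>\<^bsub>M\<^esub>}"
      by simp
    show "colon_module R M {\<zero>\<^bsub>M\<^esub>} \<subseteq> annihilator R M N"
    proof
      fix r assume r: "r \<in> colon_module R M {\<zero>\<^bsub>M\<^esub>}"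
      then have "r \<odot>\<^bsub>M\<^esub> x = \<zero>\<^bsub>M\<^esub>" if "x \<in> N" for x
        using that submodule_carrier_subset[OF N]
        unfolding colon_module_def smult_set_def by blast
      \<comment> \<open>\<open>annihilator\<close> asks for equality with \<open>{0}\<close>, not
        mere inclusion; the element \<open>m\<close> of \<open>N\<close> ensures that 0 = rm is
        actually attained.\<close>
      then have "smult_set M {r} N = {\<zero>\<^bsub>M\<^esub>}"
        using m(1) unfolding smult_set_def by force
      then show "r \<in> annihilator R M N"
        using r unfolding annihilator_def colon_module_def by simp
    qed
  qed
  then show ?thesis
    using assms unfolding completely_prime_module_def prime_module_def by blast
qed

end

lemma completely_coprime_imp_coprime:
  assumes "completely_coprime_module R M"
  shows "coprime_module R M"
proof -
  have "colon_module R M N = colon_module R M {\<zero>\<^bsub>M\<^esub>}"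
    if N: "submodule N R M" and proper: "N \<noteq> carrier M" for N
  proof
    obtain m where m: "m \<in> carrier M - N"
      using submodule_carrier_subset[OF N] proper by blast
    then have "colon_elem R M N m = colon_module R M {\<zero>\<^bsub>M\<^esub>}"
      using assms N unfolding completely_coprime_module_def by blast
    \<comment> \<open>A scalar sending all of \<open>M\<close> into \<open>N\<close> sends the
      particular element \<open>m\<close> there.\<close>
    moreover have "colon_module R M N \<subseteq> colon_elem R M N m"
      using m unfolding colon_module_def colon_elem_def smult_set_def by blast
    ultimately show "colon_module R M N \<subseteq> colon_module R M {\<zero>\<^bsub>M\<^esub>}"
      by simp
    \<comment> \<open>The colon is monotone in the submodule, and \<open>{0}\<close> lies in
      \<open>N\<close>.\<close>
    show "colon_module R M {\<zero>\<^bsub>M\<^esub>} \<subseteq> colon_module R M N"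
      using submodule_zero_closed[OF N] unfolding colon_module_def by blast
  qed
  then show ?thesis
    using assms unfolding completely_coprime_module_def coprime_module_def by blast
qed

theorem proposition4p1:
  fixes R :: "('a, 'm) ring_scheme" and M :: "('a, 'b, 'n) module_scheme"
  assumes "left_module R M"
    and "smult_set M (carrier R) (carrier M) \<noteq> {\<zero>\<^bsub>M\<^esub>}"
  shows "(completely_coprime_module R M \<longrightarrow> completely_prime_module R M) \<and>
         (completely_prime_module R M \<longrightarrow> prime_module R M) \<and>
         (completely_coprime_module R M \<longrightarrow> coprime_module R M)"
  using left_module.completely_coprime_imp_completely_prime[OF assms(1)]
    left_module.completely_prime_imp_prime[OF assms(1)]
    completely_coprime_imp_coprime[of R M]
  by blast

end
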